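(* There is a universal constant $C>0$ such that the following holds. Let $(\Omega,\Pi)$ be a probability space and $n\ge 1$, and let $(\mathrm{P}_t)_{t\ge 0}$ be a symmetric Markov semigroup on $L^2(\Omega^n,\Pi^{\otimes n})$ with a chaos decomposition $$L^2(\Omega^n,\Pi^{\otimes n})=\bigoplus_{\ell}\mathcal{W}_\ell .$$ Let $\mathcal{F}\subseteq L^2(\Omega^n,\Pi^{\otimes n})$ be a family of functions with $\|f\|\le 1$ for all $f\in\mathcal{F}$, and suppose $(\mathrm{P}_t)_{t\ge0}$ is monotone compatible with $\mathcal{F}$. Suppose furthermore that there exists an integer $j^*>0$ such that every $f\in\mathcal{F}$ satisfies $f_\ell=0$ for all $\ell$ not divisible by $j^*$, i.e. $f=\bigoplus_{\ell=0}^\infty f_{\ell\cdot j^*}$. Then for all $f,g\in\mathcal{F}$, $$\langle f,g\rangle-f_0g_0\;\ge\;\frac1C\cdot\Phi\big(\langle f_{j^*},g_{j^*}\rangle\big),$$ where $\Phi:[0,1]\to[0,1]$ is $\Phi(x)=\min\left\{x,\frac{x}{\log^2(1/x)}\right\}$.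
   Context: $L^2(\Omega^n,\Pi^{\otimes n})$ is the space of real-valued square-integrable functions, with $\langle f,g\rangle=\mathbb{E}_{x\sim\Pi^{\otimes n}}[f(x)g(x)]$ and $\|f\|=\langle f,f\rangle^{1/2}$. Markov semigroup: a collection of linear operators $(\mathrm{P}_t)_{t\ge0}$ on $L^2(\Omega^n,\Pi^{\otimes n})$ such that (1) $\mathrm{P}_0=\mathrm{Id}$; (2) $\mathrm{P}_s\circ\mathrm{P}_t=\mathrm{P}_{s+t}$ for all $s,t\ge0$; (3) for all $t\ge 0$, $\mathrm{P}_t1=1$, and $\mathrm{P}_tf\ge0$ almost everywhere whenever $f\ge0$ almost everywhere. It is symmetric if $\langle f,\mathrm{P}_tg\rangle=\langle\mathrm{P}_tf,g\rangle$ for all $t\ge0$ and all $f,g$. Chaos decomposition with respect to $(\mathrm{P}_t)_{t\ge0}$: an orthogonal decomposition $L^2(\Omega^n,\Pi^{\otimes n})=\bigoplus_{i=0}^\infty\mathcal{W}_i$ such that (1) $\mathcal{W}_0=\mathrm{span}(1)$, where $1$ is the constant function; (2) for all $t\ge0$ there is $\lambda_t\in[0,1]$ such that $\mathrm{P}_tf=\lambda_t^if$ for every $i$ and every $f\in\mathcal{W}_i$; (3) if $t_1>t_2$ then $\lambda_{t_1}<\lambda_{t_2}$. For a function $f$, $f_i$ denotes the orthogonal projection of $f$ onto $\mathcal{W}_i$; $f_0=\langle f,1\rangle$ is identified with a real number. Monotone compatible: $(\mathrm{P}_t)_{t\ge0}$ is monotone compatible with $\mathcal{F}$ if for all $f,g\in\mathcal{F}$,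 $\frac{\partial}{\partial t}\langle\mathrm{P}_tf,g\rangle\le0$ (for $t>0$). Conventions for $\Phi$: $\Phi(0)=0$, $\Phi(1)=1$. The inequality is read as including that the argument of $\Phi$ lies in its domain $[0,1]$. *)

theory Defs
  imports "HOL-Probability.Probability"
begin

text \<open>
  Elements of the Hilbert space of square-integrable functions are given by measurable
  representatives. All notions below respect almost everywhere equality: operators are required
  to be compatible with it, and subspaces are required to be saturated under it.
\<close>

definition L2 :: "'b measure \<Rightarrow> ('b \<Rightarrow> real) set" where
  "L2 N = {f \<in> borel_measurable N. integrable N (\<lambda>x. (f x)\<^sup>2)}"

definition l2_inner :: "'b measure \<Rightarrow> ('b \<Rightarrow> real) \<Rightarrow> ('b \<Rightarrow> real) \<Rightarrow> real" where
  "l2_inner N f g = (\<integral>x. f x * g x \<partial>N)"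

definition l2_norm :: "'b measure \<Rightarrow> ('b \<Rightarrow> real) \<Rightarrow> real" where
  "l2_norm N f = sqrt (l2_inner N f f)"

definition l2_operator :: "'b measure \<Rightarrow> (('b \<Rightarrow> real) \<Rightarrow> ('b \<Rightarrow> real)) \<Rightarrow> bool" where
  "l2_operator N T \<longleftrightarrow>
     (\<forall>f\<in>L2 N. T f \<in> L2 N) \<and>
     (\<forall>f\<in>L2 N. \<forall>g\<in>L2 N. (AE x in N. f x = g x) \<longrightarrow> (AE x in N. T f x = T g x)) \<and>
     (\<forall>f\<in>L2 N. \<forall>g\<in>L2 N. \<forall>a b :: real.
        AE x in N. T (\<lambda>y. a * f y + b * g y) x = a * T f x + b * T g x)"

definition markov_semigroup ::
    "'b measure \<Rightarrow> (real \<Rightarrow> ('b \<Rightarrow> real) \<Rightarrow> ('b \<Rightarrow> real)) \<Rightarrow> bool" where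
  "markov_semigroup N P \<longleftrightarrow>
     (\<forall>t\<ge>0. l2_operator N (P t)) \<and>
     (\<forall>f\<in>L2 N. AE x in N. P 0 f x = f x) \<and>
     (\<forall>s\<ge>0. \<forall>t\<ge>0. \<forall>f\<in>L2 N. AE x in N. P s (P t f) x = P (s + t) f x) \<and>
     (\<forall>t\<ge>0. AE x in N. P t (\<lambda>_. 1) x = 1) \<and>
     (\<forall>t\<ge>0. \<forall>f\<in>L2 N. (AE x in N. 0 \<le> f x) \<longrightarrow> (AE x in N. 0 \<le> P t f x))"

definition symmetric_semigroup ::
    "'b measure \<Rightarrow> (real \<Rightarrow> ('b \<Rightarrow> real) \<Rightarrow> ('b \<Rightarrow> real)) \<Rightarrow> bool" where
  "symmetric_semigroup N P \<longleftrightarrow>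
     (\<forall>t\<ge>0. \<forall>f\<in>L2 N. \<forall>g\<in>L2 N. l2_inner N f (P t g) = l2_inner N (P t f) g)"

definition l2_subspace :: "'b measure \<Rightarrow> ('b \<Rightarrow> real) set \<Rightarrow> bool" where
  "l2_subspace N V \<longleftrightarrow>
     V \<subseteq> L2 N \<and> (\<lambda>_. 0) \<in> V \<and>
     (\<forall>f\<in>V. \<forall>g\<in>V. \<forall>a b :: real. (\<lambda>x. a * f x + b * g x) \<in> V) \<and>
     (\<forall>f\<in>V. \<forall>g\<in>L2 N. (AE x in N. f x = g x) \<longrightarrow> g \<in> V)"

text \<open>
  The direct sum is the Hilbert space direct sum: every element is a norm-convergent series of
  elements of the summands. The summands are then automatically closed, since each of them is the
  orthogonal complement of the others.
\<close>

definition orthogonal_decomposition :: "'b measure \<Rightarrow> (nat \<Rightarrow> ('b \<Rightarrow> real) set) \<Rightarrow> bool" where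
  "orthogonal_decomposition N W \<longleftrightarrow>
     (\<forall>i. l2_subspace N (W i)) \<and>
     (\<forall>i j. i \<noteq> j \<longrightarrow> (\<forall>f\<in>W i. \<forall>g\<in>W j. l2_inner N f g = 0)) \<and>
     (\<forall>f\<in>L2 N. \<exists>w. (\<forall>i. w i \<in> W i) \<and>
        (\<lambda>m. l2_norm N (\<lambda>x. f x - (\<Sum>i<m. w i x))) \<longlonglongrightarrow> 0)"

definition chaos_decomposition ::
    "'b measure \<Rightarrow> (real \<Rightarrow> ('b \<Rightarrow> real) \<Rightarrow> ('b \<Rightarrow> real)) \<Rightarrow> (nat \<Rightarrow> ('b \<Rightarrow> real) set) \<Rightarrow> bool" where
  "chaos_decomposition N P W \<longleftrightarrow>
     orthogonal_decomposition N W \<and>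
     W 0 = {f \<in> L2 N. \<exists>c. AE x in N. f x = c} \<and>
     (\<exists>lam :: real \<Rightarrow> real.
        (\<forall>t\<ge>0. lam t \<in> {0..1} \<and> (\<forall>i. \<forall>f\<in>W i. AE x in N. P t f x = lam t ^ i * f x)) \<and>
        (\<forall>t1 t2. 0 \<le> t2 \<and> t2 < t1 \<longrightarrow> lam t1 < lam t2))"

text \<open>A representative of the orthogonal projection, determined up to almost everywhere equality.\<close>

definition l2_proj :: "'b measure \<Rightarrow> ('b \<Rightarrow> real) set \<Rightarrow> ('b \<Rightarrow> real) \<Rightarrow> ('b \<Rightarrow> real)" where
  "l2_proj N V f = (SOME g. g \<in> V \<and> (\<forall>h\<in>V. l2_inner N (\<lambda>x. f x - g x) h = 0))"

definition monotone_compatible ::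
    "'b measure \<Rightarrow> (real \<Rightarrow> ('b \<Rightarrow> real) \<Rightarrow> ('b \<Rightarrow> real)) \<Rightarrow> ('b \<Rightarrow> real) set \<Rightarrow> bool" where
  "monotone_compatible N P F \<longleftrightarrow>
     (\<forall>f\<in>F. \<forall>g\<in>F. \<forall>t>0. \<exists>D\<le>0.
        ((\<lambda>s. l2_inner N (P s f) g) has_real_derivative D) (at t))"

text \<open>
  The values at the endpoints are fixed explicitly; with the convention \<^term>\<open>x / 0 = (0::real)\<close>
  the formula would give 0 instead of 1 at the right endpoint.
\<close>

definition Phi :: "real \<Rightarrow> real" where
  "Phi x = (if x = 0 then 0 else if x = 1 then 1 else min x (x / (ln (1 / x))\<^sup>2))"

end

theory Submission
  imports Defs
begin

text \<open>
  Put \<open>a\<^sub>l = \<langle>f\<^sub>l\<^sub>j, g\<^sub>l\<^sub>j\<rangle>\<close> and \<open>h x = \<Sum>\<^sub>l a\<^sub>l x\<^sup>l\<close>. The eigenvalues satisfy \<open>\<lambda>\<^sub>t = exp (- c t)\<close>, so that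
  \<open>h x = \<langle>P\<^sub>t f, g\<rangle>\<close> for \<open>x = \<lambda>\<^sub>t\<^sup>j\<close> and monotone compatibility says that \<open>h\<close> is nondecreasing on
  \<open>(0, 1)\<close>; by Abel's limit theorem \<open>0 \<le> h x - h 0 \<le> \<Delta>\<close> there, where
  \<open>\<Delta> = \<langle>f, g\<rangle> - f\<^sub>0 g\<^sub>0\<close>. The coefficient \<open>a\<^sub>1 = h' 0\<close> is recovered from the values of \<open>h\<close> at the
  \<open>d\<close> quadratically spaced nodes \<open>L k\<^sup>2 / d\<^sup>2\<close> by Lagrange interpolation, with weights of total
  size \<open>O(d\<^sup>2)\<close>, up to an error exponentially small in \<open>d\<close> because \<open>\<bar>a\<^sub>l\<bar> \<le> 1\<close>. Choosing \<open>d\<close> of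
  order \<open>ln (1 / a\<^sub>1)\<close> gives \<open>a\<^sub>1 = O(d\<^sup>2 \<Delta>)\<close>.
\<close>

section \<open>Alternating binomial sums and the interpolation weights\<close>

text \<open>An \<open>n\<close>-th finite difference annihilates polynomials of degree below
  \<open>n\<close>. The induction splits off one factor \<open>i + c\<close> and absorbs the
  \<open>i\<close> into the binomial coefficient; this lowers \<open>n\<close> by one and shifts the
  index, so \<open>c\<close> must stay arbitrary.\<close>

lemma alternating_binomial_power_sum_eq_0:
  fixes c :: "'a::comm_ring_1"
  assumes "m < n"
  shows "(\<Sum>i\<le>n. (-1) ^ i * of_nat (n choose i) * (of_nat i + c) ^ m) = 0"
  using assms
proof (induction m arbitrary: n c)
  case 0
  then show ?case using choose_alternating_sum[of n, where ?'a='a] by simp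
next
  case (Suc m)
  then obtain k where n: "n = Suc k" and k: "m < k" by (cases n) auto
  have absorb: "(of_nat (n choose Suc i) * of_nat (Suc i) :: 'a) = of_nat n * of_nat (k choose i)" for i
    using Suc_times_binomial_eq[of k i] unfolding n by (metis of_nat_mult)
  have "(\<Sum>i\<le>n. (-1) ^ i * of_nat (n choose i) * (of_nat i + c) ^ Suc m)
      = c * (\<Sum>i\<le>n. (-1) ^ i * of_nat (n choose i) * (of_nat i + c) ^ m)
        + (\<Sum>i\<le>n. (-1) ^ i * (of_nat (n choose i) * of_nat i) * (of_nat i + c) ^ m)"
    by (simp add: sum_distrib_left sum.distrib[symmetric] algebra_simps)
  also have "(\<Sum>i\<le>n. (-1) ^ i * of_nat (n choose i) * (of_nat i + c) ^ m) = 0"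
    using Suc by simp
  also have "(\<Sum>i\<le>n. (-1) ^ i * (of_nat (n choose i) * of_nat i) * (of_nat i + c) ^ m)
      = - of_nat n * (\<Sum>i\<le>k. (-1) ^ i * of_nat (k choose i) * (of_nat i + (1 + c)) ^ m)"
    unfolding n sum.atMost_Suc_shift sum_distrib_left
    using absorb unfolding n by (simp add: algebra_simps sum_negf)
  also have "(\<Sum>i\<le>k. (-1) ^ i * of_nat (k choose i) * (of_nat i + (1 + c)) ^ m) = 0"
    using Suc.IH k by blast
  finally show ?case by simp
qed

text \<open>
  The Lagrange polynomials for the nodes \<open>0, 1, 4, \<dots>, d\<^sup>2\<close> have derivative
  \<open>deriv_weight d k / k\<^sup>2\<close> at 0, for \<open>1 \<le> k \<le> d\<close>. These nodes imitate the Chebyshev nodes near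
  the endpoint, which is what makes the weights bounded.
\<close>

definition deriv_weight :: "nat \<Rightarrow> nat \<Rightarrow> real" where
  "deriv_weight d k = 2 * (-1) ^ Suc k * real (2 * d choose (d + k)) / real (2 * d choose d)"

lemma abs_deriv_weight_le: "\<bar>deriv_weight d k\<bar> \<le> 2"
proof -
  have "real (2 * d choose (d + k)) \<le> real (2 * d choose d)"
    using binomial_maximum' by simp
  moreover have "real (2 * d choose d) > 0" by simp
  ultimately show ?thesis by (simp add: deriv_weight_def abs_mult power_abs pos_divide_le_eq)
qed

text \<open>Exactness of the interpolation: with nodes \<open>k ^ 2\<close>, the weights recover the
  value at 0 of every polynomial of degree below \<open>d\<close>. The alternating sum of order
  \<open>2 * d\<close> centred at \<open>d\<close> vanishes by the previous lemma. Its two halves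
  agree because the power is even, and the central term is nonzero only for
  \<open>r = 0\<close>.\<close>

lemma sum_deriv_weight_even_power:
  assumes "r < d"
  shows "(\<Sum>k=1..d. deriv_weight d k * real k ^ (2 * r)) = (if r = 0 then 1 else 0)"
proof -
  define t where "t i = (-1) ^ i * real (2 * d choose i) * (real i + (- real d)) ^ (2 * r)" for i
  define B where "B = (\<Sum>k=1..d. (-1) ^ k * real (2 * d choose (d + k)) * real k ^ (2 * r))"
  have pos: "real (2 * d choose d) > 0" by simp
  have "0 = (\<Sum>i\<le>2 * d. t i)"
    unfolding t_def using alternating_binomial_power_sum_eq_0[of "2 * r" "2 * d" "- real d"] assms by simp
  also have "{..2 * d} = {..<d} \<union> ({d} \<union> {d+1..2*d})" by auto
  also have "sum t \<dots> = sum t {..<d} + (t d + sum t {d+1..2*d})"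
    by (subst sum.union_disjoint, auto)+
  also have "sum t {d+1..2*d} = (-1) ^ d * B"
  proof -
    have "sum t {d+1..2*d} = (\<Sum>k=1..d. t (d + k))"
      by (rule sum.reindex_bij_witness[of _ "\<lambda>k. d + k" "\<lambda>i. i - d"]) auto
    also have "\<dots> = (-1) ^ d * B"
      unfolding B_def sum_distrib_left by (intro sum.cong) (auto simp: t_def power_add)
    finally show ?thesis .
  qed
  also have "sum t {..<d} = (-1) ^ d * B"
  proof -
    have "sum t {..<d} = (\<Sum>k=1..d. t (d - k))"
      by (rule sum.reindex_bij_witness[of _ "\<lambda>k. d - k" "\<lambda>i. d - i"]) auto
    also have "\<dots> = (-1) ^ d * B"
      unfolding B_def sum_distrib_left
    proof (intro sum.cong refl)
      fix k assume k: "k \<in> {1..d}"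
      have "(2 * d choose (d - k)) = (2 * d choose (d + k))"
        using k binomial_symmetric[of "d - k" "2 * d"] by simp
      moreover have "(-1::real) ^ (d - k) = (-1) ^ d * (-1) ^ k"
        using k by (simp add: power_diff[of "-1::real"] power_add[symmetric] divide_simps minus_one_power_iff)
      moreover have "(real (d - k) + - real d) ^ (2 * r) = real k ^ (2 * r)"
        using k by (simp add: of_nat_diff)
      ultimately show "t (d - k) = (-1) ^ d * ((-1) ^ k * real (2 * d choose (d + k)) * real k ^ (2 * r))"
        unfolding t_def by simp
    qed
    finally show ?thesis .
  qed
  finally have "(-1) ^ d * (2 * B + real (2 * d choose d) * 0 ^ (2 * r)) = 0"
    by (simp add: t_def algebra_simps)
  then have B: "2 * B = - real (2 * d choose d) * 0 ^ (2 * r)" by simp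
  have "(\<Sum>k=1..d. deriv_weight d k * real k ^ (2 * r)) = - 2 * B / real (2 * d choose d)"
    unfolding B_def deriv_weight_def sum_distrib_left sum_divide_distrib
    by (intro sum.cong) auto
  also have "\<dots> = 0 ^ (2 * r)" using B pos by (simp add: field_simps)
  finally show ?thesis by (simp add: power_0_left)
qed

lemma sum_inverse_square_le: "(\<Sum>k=1..d. 1 / (real k)\<^sup>2) \<le> 2"
proof -
  \<comment> \<open>The subtracted term makes the induction close: the new summand is dominated by a
    telescoping difference.\<close>
  have bound: "(\<Sum>k=1..Suc m. 1 / (real k)\<^sup>2) \<le> 2 - 1 / real (Suc m)" for m
  proof (induction m)
    case (Suc m)
    have "1 / (real (Suc (Suc m)))\<^sup>2 \<le> 1 / real (Suc m) - 1 / real (Suc (Suc m))"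
    proof -
      have "1 / (real (Suc (Suc m)))\<^sup>2 \<le> 1 / (real (Suc m) * real (Suc (Suc m)))"
        unfolding power2_eq_square by (intro divide_left_mono mult_right_mono mult_pos_pos) auto
      also have "\<dots> = 1 / real (Suc m) - 1 / real (Suc (Suc m))"
        by (simp add: field_simps)
      finally show ?thesis .
    qed
    with Suc show ?case by simp
  qed simp
  have "(\<Sum>k=1..Suc m. 1 / (real k)\<^sup>2) \<le> 2" for m
  proof -
    have "0 \<le> 1 / real (Suc m)" by simp
    with bound[of m] show ?thesis by linarith
  qed
  then show ?thesis by (cases d) auto
qed

section \<open>Power series with bounded coefficients and recovery of the linear coefficient\<close>

text \<open>Summation by parts writes the error as \<open>(1 - x)\<close> times the power series of
  the remainders \<open>r n\<close>. Since \<open>r\<close> tends to 0, the late terms contribute at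
  most \<open>e / 2\<close>, and the finitely many early ones are damped by
  \<open>1 - x\<close>.\<close>

lemma abel_limit:
  fixes a :: "nat \<Rightarrow> real"
  assumes "a sums S"
  shows "((\<lambda>x. \<Sum>n. a n * x ^ n) \<longlongrightarrow> S) (at_left 1)"
proof -
  define r where "r n = (\<Sum>i\<le>n. a i) - S" for n
  have "r \<longlonglongrightarrow> 0"
    unfolding r_def using assms by (simp add: sums_def_le LIM_zero)
  then obtain B where B: "\<And>n. \<bar>r n\<bar> \<le> B"
    by (metis Bseq_def convergentI convergent_imp_Bseq real_norm_def)
  have summ: "summable (\<lambda>n. r n * x ^ n)" if "0 < x" "x < 1" for x
  proof (rule summable_comparison_test'[of "\<lambda>n. B * x ^ n"])
    show "summable (\<lambda>n. B * x ^ n)"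
      using that by (intro summable_mult summable_geometric) auto
    show "norm (r n * x ^ n) \<le> B * x ^ n" if "n \<ge> 0" for n
      using B[of n] \<open>0 < x\<close> by (simp add: abs_mult mult_right_mono)
  qed
  have by_parts: "(\<Sum>n. a n * x ^ n) - S = (1 - x) * (\<Sum>n. r n * x ^ n)" if x: "0 < x" "x < 1" for x
  proof -
    define G where "G = (\<Sum>n. r n * x ^ n)"
    have G: "(\<lambda>n. r n * x ^ n) sums G"
      unfolding G_def using summ[OF x] by (rule summable_sums)
    have "(\<lambda>n. r (Suc n) * x ^ Suc n) sums (G - r 0)"
      using G by (subst sums_Suc_iff) simp
    moreover have "(\<lambda>n. x * (r n * x ^ n)) sums (x * G)"
      by (rule sums_mult[OF G])
    ultimately have "(\<lambda>n. r (Suc n) * x ^ Suc n - x * (r n * x ^ n)) sums (G - r 0 - x * G)"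
      by (rule sums_diff)
    also have "(\<lambda>n. r (Suc n) * x ^ Suc n - x * (r n * x ^ n)) = (\<lambda>n. a (Suc n) * x ^ Suc n)"
      by (simp add: r_def algebra_simps)
    finally have "(\<lambda>n. a n * x ^ n) sums (G - r 0 - x * G + a 0)"
      by (subst (asm) sums_Suc_iff) simp
    then have "(\<Sum>n. a n * x ^ n) = (1 - x) * G + S"
      by (simp add: sums_iff r_def algebra_simps)
    then show ?thesis unfolding G_def by simp
  qed
  show ?thesis
  proof (rule tendstoI)
    fix e :: real assume "e > 0"
    then obtain N where N: "\<And>n. n \<ge> N \<Longrightarrow> \<bar>r n\<bar> < e / 2"
      using LIMSEQ_D[OF \<open>r \<longlonglongrightarrow> 0\<close>, of "e / 2"] by auto
    have "((\<lambda>x. (1 - x) * (real N * B)) \<longlongrightarrow> (1 - 1) * (real N * B)) (at_left (1::real))"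
      by (intro tendsto_intros)
    then have "\<forall>\<^sub>F x in at_left (1::real). (1 - x) * (real N * B) < e / 2"
      using \<open>e > 0\<close> by (auto dest!: order_tendstoD(2)[where a="e / 2"])
    moreover have "\<forall>\<^sub>F x in at_left (1::real). 0 < x \<and> x < 1"
      using eventually_at_left_real[of 0 "1::real"] by (auto elim: eventually_mono)
    ultimately show "\<forall>\<^sub>F x in at_left 1. dist (\<Sum>n. a n * x ^ n) S < e"
    proof eventually_elim
      case (elim x)
      \<comment> \<open>A summable majorant: \<open>e / 2\<close> controls the remainders from
        \<open>N\<close> on, the uniform bound \<open>B\<close> those before.\<close>
      let ?b = "\<lambda>n. e / 2 * x ^ n + (if n < N then B else 0)"
      have geo: "(\<lambda>n. e / 2 * x ^ n) sums (e / 2 * (1 / (1 - x)))"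
        using elim by (intro sums_mult geometric_sums) auto
      have cut: "(\<lambda>n. if n < N then B else 0) sums (real N * B)"
        using sums_If_finite[of "\<lambda>n. n < N" "\<lambda>_. B"] by simp
      have "\<bar>r n * x ^ n\<bar> \<le> ?b n" for n
      proof (cases "n < N")
        case True
        have "\<bar>r n * x ^ n\<bar> \<le> B * 1"
          unfolding abs_mult using elim B[of n] by (intro mult_mono) (auto simp: power_le_one intro: order_trans[OF abs_ge_zero B])
        then show ?thesis using True elim \<open>e > 0\<close> by (simp add: add_increasing)
      next
        case False
        then show ?thesis using N[of n] elim by (simp add: abs_mult mult_right_mono)
      qed
      then have "norm (\<Sum>n. r n * x ^ n) \<le> (\<Sum>n. ?b n)"
        using sums_add[OF geo cut] by (intro norm_suminf_le) (auto simp: sums_iff)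
      also have "\<dots> = e / 2 * (1 / (1 - x)) + real N * B"
        using sums_add[OF geo cut] by (simp add: sums_iff)
      finally have "(1 - x) * \<bar>\<Sum>n. r n * x ^ n\<bar> \<le> (1 - x) * (e / 2 * (1 / (1 - x)) + real N * B)"
        using elim by (intro mult_left_mono) auto
      also have "\<dots> = e / 2 + (1 - x) * (real N * B)"
        using elim by (simp add: field_simps)
      finally show ?case using elim by_parts[of x] by (simp add: dist_real_def abs_mult)
    qed
  qed
qed

lemma powser_tail_le:
  fixes a :: "nat \<Rightarrow> real"
  assumes "\<And>n. \<bar>a n\<bar> \<le> 1" "0 \<le> x" "x \<le> 1 / 2"
  shows "\<bar>(\<Sum>n. a n * x ^ n) - (\<Sum>n<m. a n * x ^ n)\<bar> \<le> 2 * x ^ m"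
proof -
  have geo: "(\<lambda>n. x ^ m * x ^ n) sums (x ^ m * (1 / (1 - x)))"
    using assms by (intro sums_mult geometric_sums) auto
  have le: "norm (a (n + m) * x ^ (n + m)) \<le> x ^ m * x ^ n" for n
    using mult_right_mono[OF assms(1)[of "n + m"], of "x ^ (n + m)"] assms(2)
    by (simp add: abs_mult power_add mult_ac)
  have "summable (\<lambda>n. a n * x ^ n)"
    using summable_comparison_test'[OF sums_summable[OF geo] le] summable_iff_shift by blast
  then have "\<bar>(\<Sum>n. a n * x ^ n) - (\<Sum>n<m. a n * x ^ n)\<bar> = norm (\<Sum>n. a (n + m) * x ^ (n + m))"
    by (subst suminf_split_initial_segment[of _ m]) auto
  also have "\<dots> \<le> (\<Sum>n. x ^ m * x ^ n)"
    using sums_summable[OF geo] le by (rule norm_suminf_le[rotated])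
  also have "\<dots> = x ^ m * (1 / (1 - x))"
    using geo by (simp add: sums_iff)
  also have "\<dots> \<le> x ^ m * 2"
    using assms by (intro mult_left_mono) (auto simp: field_simps)
  finally show ?thesis by simp
qed

text \<open>After removal of \<open>a 0\<close> and of the tail, division by \<open>x\<close> leaves
  a polynomial of degree below \<open>d\<close> with value \<open>a 1\<close> at 0, which the
  weights extract exactly. What remains is to weigh the two errors, the increment of the series and
  the tail.\<close>

lemma powser_linear_coeff_le:
  fixes a :: "nat \<Rightarrow> real"
  assumes a: "\<And>n. \<bar>a n\<bar> \<le> 1"
    and L: "0 < L" "L \<le> 1 / 2" and d: "1 \<le> d"
    and \<Delta>: "\<And>x. 0 < x \<Longrightarrow> x \<le> L \<Longrightarrow> \<bar>(\<Sum>n. a n * x ^ n) - a 0\<bar> \<le> \<Delta>"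
  shows "\<bar>a 1\<bar> \<le> 4 * (real d)\<^sup>2 / L * \<Delta> + 4 * real d * L ^ d"
proof -
  define x where "x k = L * (real k)\<^sup>2 / (real d)\<^sup>2" for k
  define h where "h y = (\<Sum>n. a n * y ^ n)" for y
  define T where "T k = h (x k) - (\<Sum>n<Suc d. a n * x k ^ n)" for k
  define w where "w = deriv_weight d"
  have x: "0 < x k" "x k \<le> L" if "k \<in> {1..d}" for k
  proof -
    show "0 < x k" using that L unfolding x_def by simp
    have "(real k)\<^sup>2 \<le> (real d)\<^sup>2" using that by simp
    then show "x k \<le> L" using d L unfolding x_def by (simp add: field_simps)
  qed
  have T: "\<bar>T k\<bar> \<le> 2 * x k ^ Suc d" if "k \<in> {1..d}" for k
    unfolding T_def h_def using x[OF that] L a by (intro powser_tail_le) auto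
  have moment: "(\<Sum>k=1..d. w k * x k ^ r) = (if r = 0 then 1 else 0)" if "r < d" for r
  proof -
    have "(\<Sum>k=1..d. w k * x k ^ r) = (L / (real d)\<^sup>2) ^ r * (\<Sum>k=1..d. w k * real k ^ (2 * r))"
      unfolding x_def sum_distrib_left
      by (intro sum.cong) (auto simp: power_mult power_divide power_mult_distrib)
    then show ?thesis using sum_deriv_weight_even_power[OF that] by (simp add: w_def)
  qed
  have "(\<Sum>k=1..d. w k * ((h (x k) - a 0 - T k) / x k))
      = (\<Sum>k=1..d. \<Sum>n<d. a (Suc n) * (w k * x k ^ n))"
  proof (intro sum.cong refl)
    fix k assume k: "k \<in> {1..d}"
    have "h (x k) - a 0 - T k = (\<Sum>n<d. a (Suc n) * x k ^ Suc n)"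
      unfolding T_def by (subst sum.lessThan_Suc_shift) simp
    also have "\<dots> = x k * (\<Sum>n<d. a (Suc n) * x k ^ n)"
      by (simp add: sum_distrib_left mult_ac)
    finally have "(h (x k) - a 0 - T k) / x k = (\<Sum>n<d. a (Suc n) * x k ^ n)"
      using x[OF k] by simp
    then show "w k * ((h (x k) - a 0 - T k) / x k) = (\<Sum>n<d. a (Suc n) * (w k * x k ^ n))"
      by (simp add: sum_distrib_left mult_ac)
  qed
  also have "\<dots> = (\<Sum>n<d. a (Suc n) * (\<Sum>k=1..d. w k * x k ^ n))"
    by (subst sum.swap) (simp add: sum_distrib_left)
  also have "\<dots> = (\<Sum>n<d. if n = 0 then a (Suc n) else 0)"
    using moment by (intro sum.cong) auto
  also have "\<dots> = a 1" using d by (subst sum.delta) auto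
  finally have "\<bar>a 1\<bar> = \<bar>\<Sum>k=1..d. w k * ((h (x k) - a 0 - T k) / x k)\<bar>" by simp
  \<comment> \<open>Dividing the increment by \<open>x k\<close> produces the factor
    \<open>1 / k ^ 2\<close>, whose sum is bounded, so that only the factor \<open>d ^ 2 / L\<close>
    is lost. The tail, of order \<open>Suc d\<close>, still has order \<open>d\<close> after the
    division.\<close>
  also have "\<dots> \<le> (\<Sum>k=1..d. 2 * (inverse L * (real d)\<^sup>2 * \<Delta> * (1 / (real k)\<^sup>2)) + 4 * L ^ d)"
  proof (intro order_trans[OF sum_abs] sum_mono)
    fix k assume k: "k \<in> {1..d}"
    have "\<bar>(h (x k) - a 0 - T k) / x k\<bar> \<le> (\<Delta> + 2 * x k ^ Suc d) / x k"
      using \<Delta>[OF x[OF k]] T[OF k] x[OF k] unfolding h_def[symmetric] abs_divide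
      by (simp add: divide_right_mono)
    also have "\<dots> = \<Delta> / x k + 2 * x k ^ d"
      using x[OF k] by (simp add: field_simps)
    also have "x k ^ d \<le> L ^ d"
      using x[OF k] by (intro power_mono) auto
    also have "\<Delta> / x k = inverse L * (real d)\<^sup>2 * \<Delta> * (1 / (real k)\<^sup>2)"
      using L d k unfolding x_def by (simp add: field_simps)
    finally have "\<bar>(h (x k) - a 0 - T k) / x k\<bar> \<le> inverse L * (real d)\<^sup>2 * \<Delta> * (1 / (real k)\<^sup>2) + 2 * L ^ d"
      by simp
    then have "\<bar>w k\<bar> * \<bar>(h (x k) - a 0 - T k) / x k\<bar>
        \<le> 2 * (inverse L * (real d)\<^sup>2 * \<Delta> * (1 / (real k)\<^sup>2) + 2 * L ^ d)"
      unfolding w_def by (intro mult_mono abs_deriv_weight_le) auto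
    then show "\<bar>w k * ((h (x k) - a 0 - T k) / x k)\<bar>
        \<le> 2 * (inverse L * (real d)\<^sup>2 * \<Delta> * (1 / (real k)\<^sup>2)) + 4 * L ^ d"
      by (simp add: abs_mult)
  qed
  also have "\<dots> = 2 * (inverse L * (real d)\<^sup>2 * \<Delta>) * (\<Sum>k=1..d. 1 / (real k)\<^sup>2) + 4 * real d * L ^ d"
    by (simp add: sum.distrib sum_distrib_left mult_ac)
  also have "\<dots> \<le> 2 * (inverse L * (real d)\<^sup>2 * \<Delta>) * 2 + 4 * real d * L ^ d"
  proof -
    have "\<Delta> \<ge> 0" using order_trans[OF abs_ge_zero \<Delta>[of L]] L by simp
    then show ?thesis
      using L by (intro add_right_mono mult_left_mono sum_inverse_square_le) auto
  qed
  finally show ?thesis using L by (simp add: field_simps)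
qed

text \<open>Monotonicity confines the series on (0, 1) between its limits at the two ends,
  \<open>a 0\<close> and \<open>S\<close>, so every increment is at most \<open>S - a 0\<close>. The
  bound on the linear coefficient then applies, with the number of nodes adapted to
  \<open>a 1\<close>.\<close>

lemma mono_powser_increment_ge_Phi:
  fixes a :: "nat \<Rightarrow> real"
  assumes a: "\<And>n. \<bar>a n\<bar> \<le> 1" and S: "a sums S"
    and mono: "\<And>x y. 0 < x \<Longrightarrow> x \<le> y \<Longrightarrow> y < 1 \<Longrightarrow> (\<Sum>n. a n * x ^ n) \<le> (\<Sum>n. a n * y ^ n)"
  shows "0 \<le> a 1" "S - a 0 \<ge> 1 / 10 ^ 6 * Phi (a 1)"
proof -
  define h where "h x = (\<Sum>n. a n * x ^ n)" for x
  have upper: "h x \<le> S" if "0 < x" "x < 1" for x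
  proof (rule tendsto_lowerbound[OF abel_limit[OF S]])
    show "\<forall>\<^sub>F y in at_left 1. h x \<le> (\<Sum>n. a n * y ^ n)"
      using eventually_at_left_real[OF that(2)]
      by (rule eventually_mono) (use that in \<open>auto simp: h_def intro!: mono\<close>)
  qed simp
  have lower: "a 0 \<le> h x" if "0 < x" "x < 1" for x
  proof (rule tendsto_upperbound)
    show "((\<lambda>y. a 0 - 2 * y) \<longlongrightarrow> a 0) (at_right 0)"
      by (auto intro!: tendsto_eq_intros)
    show "\<forall>\<^sub>F y in at_right 0. a 0 - 2 * y \<le> h x"
      using eventually_at_right_real[of 0 "min x (1 / 2)"]
    proof (rule eventually_mono)
      show "0 < min x (1 / 2)" using that by simp
      fix y assume y: "y \<in> {0<..<min x (1 / 2)}"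
      have "h y \<le> h x" unfolding h_def using y that by (intro mono) auto
      moreover have "\<bar>h y - a 0\<bar> \<le> 2 * y"
        using powser_tail_le[of a y 1] a y by (simp add: h_def)
      ultimately show "a 0 - 2 * y \<le> h x" by simp
    qed
  qed simp
  \<comment> \<open>Since \<open>a 0 \<le> h y\<close>, the linear term must outweigh the quadratic
    error; divide by \<open>y\<close> and let \<open>y\<close> tend to 0.\<close>
  show a1: "0 \<le> a 1"
  proof (rule tendsto_lowerbound)
    show "((\<lambda>y. a 1 + 2 * y) \<longlongrightarrow> a 1) (at_right 0)"
      by (auto intro!: tendsto_eq_intros)
    show "\<forall>\<^sub>F y in at_right 0. 0 \<le> a 1 + 2 * y"
      using eventually_at_right_real[of 0 "1 / 2"]
    proof (rule eventually_mono)
      fix y :: real assume y: "y \<in> {0<..<1 / 2}"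
      have "\<bar>h y - (a 0 + a 1 * y)\<bar> \<le> 2 * y ^ 2"
        using powser_tail_le[of a y 2] a y by (simp add: h_def numeral_2_eq_2)
      moreover have "a 0 \<le> h y" using lower y by auto
      ultimately have "0 \<le> (a 1 + 2 * y) * y"
        by (simp add: algebra_simps power2_eq_square)
      then show "0 \<le> a 1 + 2 * y" using y by (simp add: zero_le_mult_iff)
    qed simp
  qed simp
  define \<Delta> where "\<Delta> = S - a 0"
  have \<Delta>: "\<bar>h x - a 0\<bar> \<le> \<Delta>" if "0 < x" "x < 1" for x
    using lower[OF that] upper[OF that] by (simp add: \<Delta>_def)
  have "\<Delta> \<ge> 0" using \<Delta>[of "1 / 2"] by simp
  have "\<Delta> \<ge> 1 / 10 ^ 6 * Phi (a 1)"
  proof (cases "a 1 = 0")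
    case True
    then show ?thesis using \<open>\<Delta> \<ge> 0\<close> by (simp add: Phi_def)
  next
    case False
    with a1 have pos: "0 < a 1" by simp
    have le1: "a 1 \<le> 1" using a[of 1] by simp
    define l where "l = ln (1 / a 1)"
    have l: "0 \<le> l" using pos le1 unfolding l_def by simp
    \<comment> \<open>Large enough for \<open>exp (- d) \<le> a 1\<close>. The maximum with 1 covers
      \<open>a 1 = 1\<close>, where \<open>l = 0\<close>.\<close>
    define d where "d = max 1 (nat \<lceil>l\<rceil>)"
    have d: "1 \<le> d" "l \<le> real d" unfolding d_def by linarith+
    have exp_d: "exp (- real d) \<le> a 1"
    proof -
      have "exp (- real d) \<le> exp (- l)" using d by simp
      also have "\<dots> = a 1" using pos unfolding l_def by (simp add: ln_div)
      finally show ?thesis .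
    qed
    have e4: "exp (4::real) \<le> 81"
    proof -
      have "exp (4::real) = exp 1 ^ 4" by (simp flip: exp_of_nat_mult)
      also have "\<dots> \<le> 3 ^ 4" using exp_le by (intro power_mono) auto
      finally show ?thesis by simp
    qed
    \<comment> \<open>The choice \<open>L = exp (- 4)\<close> makes the tail error at most
      \<open>exp (- d) / 2\<close>, hence at most \<open>a 1 / 2\<close>, which the left side
      absorbs: three of the four exponential factors pay for \<open>8 * d\<close>.\<close>
    have "\<bar>a 1\<bar> \<le> 4 * (real d)\<^sup>2 / exp (- 4) * \<Delta> + 4 * real d * exp (- 4) ^ d"
    proof (rule powser_linear_coeff_le)
      show "exp (- 4) \<le> (1 / 2 :: real)"
        using exp_ge_add_one_self[of "4::real"] by (simp add: exp_minus field_simps)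
      show "\<bar>(\<Sum>n. a n * x ^ n) - a 0\<bar> \<le> \<Delta>" if "0 < x" "x \<le> exp (- 4)" for x
      proof -
        have "exp (- 4) < (1::real)" by simp
        then show ?thesis using \<Delta>[of x] that unfolding h_def by linarith
      qed
    qed (use a d in auto)
    moreover have "4 * real d * exp (- 4) ^ d \<le> exp (- real d) / 2"
    proof -
      have "8 * real d \<le> (1 + real d) ^ 3"
      proof -
        define u where "u = real d - 1"
        have "u \<ge> 0" using d(1) by (simp add: u_def)
        moreover have "(1 + real d) ^ 3 - 8 * real d = 4 * u + 6 * u ^ 2 + u ^ 3"
          by (simp add: u_def power2_eq_square power3_eq_cube algebra_simps)
        ultimately have "0 \<le> (1 + real d) ^ 3 - 8 * real d" by simp
        then show ?thesis by simp
      qed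
      also have "\<dots> \<le> exp (real d) ^ 3"
        using exp_ge_add_one_self by (intro power_mono) auto
      finally have "8 * real d \<le> exp (3 * real d)" by (simp flip: exp_of_nat_mult)
      then have "8 * real d * exp (- 4 * real d) \<le> exp (3 * real d) * exp (- 4 * real d)"
        by (intro mult_right_mono) auto
      then show ?thesis by (simp add: exp_of_nat_mult[symmetric] exp_add[symmetric] mult.commute)
    qed
    moreover have "4 * (real d)\<^sup>2 / exp (- 4) * \<Delta> = 4 * (real d)\<^sup>2 * exp 4 * \<Delta>"
      by (simp add: exp_minus divide_inverse)
    ultimately have "a 1 / 2 \<le> 4 * (real d)\<^sup>2 * exp 4 * \<Delta>"
      using exp_d by linarith
    also have "\<dots> \<le> 4 * (real d)\<^sup>2 * 81 * \<Delta>"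
      using e4 \<open>\<Delta> \<ge> 0\<close> by (intro mult_right_mono mult_left_mono) auto
    finally have main: "a 1 \<le> 648 * (real d)\<^sup>2 * \<Delta>" by simp
    show ?thesis
    \<comment> \<open>The two cases match the two terms of the minimum in \<open>Phi\<close>: for
      \<open>l \<le> 1\<close> a single node suffices, otherwise rounding costs at most a factor 2
      in \<open>d\<close>. The constants 648 and 2592 lie well below \<open>10 ^ 6\<close>.\<close>
    proof (cases "l \<le> 1")
      case True
      then have "d = 1" unfolding d_def using l by (simp add: max_def) linarith
      moreover have "Phi (a 1) \<le> a 1" using pos by (auto simp: Phi_def)
      ultimately show ?thesis using main \<open>\<Delta> \<ge> 0\<close> by simp
    next
      case False
      then have "real d \<le> 2 * l" unfolding d_def by linarith
      then have "(real d)\<^sup>2 \<le> (2 * l)\<^sup>2" by (intro power_mono) auto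
      then have "648 * (real d)\<^sup>2 * \<Delta> \<le> 648 * (2 * l)\<^sup>2 * \<Delta>"
        using \<open>\<Delta> \<ge> 0\<close> by (intro mult_right_mono mult_left_mono) auto
      with main have "a 1 / l\<^sup>2 \<le> 2592 * \<Delta>"
        using False by (simp add: field_simps)
      moreover have "Phi (a 1) \<le> a 1 / l\<^sup>2"
        using pos False by (auto simp: Phi_def l_def)
      ultimately show ?thesis using \<open>\<Delta> \<ge> 0\<close> by simp
    qed
  qed
  then show "S - a 0 \<ge> 1 / 10 ^ 6 * Phi (a 1)" by (simp add: \<Delta>_def)
qed

section \<open>Inner product and Cauchy-Schwarz inequality for square-integrable functions\<close>

lemma L2_D: "f \<in> L2 N \<Longrightarrow> f \<in> borel_measurable N" "f \<in> L2 N \<Longrightarrow> integrable N (\<lambda>x. (f x)\<^sup>2)"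
  by (auto simp: L2_def)

lemma integrable_mult_L2:
  assumes "f \<in> L2 N" "g \<in> L2 N"
  shows "integrable N (\<lambda>x. f x * g x)"
proof (rule Bochner_Integration.integrable_bound)
  show "integrable N (\<lambda>x. (f x)\<^sup>2 + (g x)\<^sup>2)"
    using assms by (intro Bochner_Integration.integrable_add L2_D)
  show "(\<lambda>x. f x * g x) \<in> borel_measurable N"
    using assms[THEN L2_D(1)] by measurable
  have "\<bar>u * v\<bar> \<le> u\<^sup>2 + v\<^sup>2" for u v :: real
  proof -
    have "2 * (\<bar>u\<bar> * \<bar>v\<bar>) \<le> u\<^sup>2 + v\<^sup>2"
      using sum_squares_bound[of "\<bar>u\<bar>" "\<bar>v\<bar>"] by (simp add: mult.assoc)
    moreover have "0 \<le> \<bar>u\<bar> * \<bar>v\<bar>" by simp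
    ultimately show ?thesis unfolding abs_mult by linarith
  qed
  then show "AE x in N. norm (f x * g x) \<le> norm ((f x)\<^sup>2 + (g x)\<^sup>2)"
    by (intro AE_I2) (simp only: real_norm_def abs_of_nonneg[OF sum_power2_ge_zero])
qed

lemma L2_lincomb:
  assumes "f \<in> L2 N" "g \<in> L2 N"
  shows "(\<lambda>x. a * f x + b * g x) \<in> L2 N"
proof -
  have "integrable N (\<lambda>x. a\<^sup>2 * (f x)\<^sup>2 + b\<^sup>2 * (g x)\<^sup>2 + 2 * a * b * (f x * g x))"
    using assms by (intro Bochner_Integration.integrable_add integrable_mult_right L2_D integrable_mult_L2)
  moreover have "(a * f x + b * g x)\<^sup>2 = a\<^sup>2 * (f x)\<^sup>2 + b\<^sup>2 * (g x)\<^sup>2 + 2 * a * b * (f x * g x)" for x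
    by (simp add: power2_eq_square algebra_simps)
  moreover have "(\<lambda>x. a * f x + b * g x) \<in> borel_measurable N"
    using assms[THEN L2_D(1)] by measurable
  ultimately show ?thesis by (simp add: L2_def)
qed

lemma L2_diff: "f \<in> L2 N \<Longrightarrow> g \<in> L2 N \<Longrightarrow> (\<lambda>x. f x - g x) \<in> L2 N"
  using L2_lincomb[of f N g 1 "-1"] by simp

lemma L2_sum:
  fixes m :: nat
  assumes "\<And>i. w i \<in> L2 N"
  shows "(\<lambda>x. \<Sum>i<m. w i x) \<in> L2 N"
proof (induction m)
  case 0
  then show ?case by (simp add: L2_def)
next
  case (Suc m)
  then show ?case using L2_lincomb[of "\<lambda>x. \<Sum>i<m. w i x" N "w m" 1 1] assms by simp
qed

lemma l2_inner_commute: "l2_inner N f g = l2_inner N g f"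
  by (simp add: l2_inner_def mult.commute)

lemma l2_inner_diff_left:
  assumes "f \<in> L2 N" "g \<in> L2 N" "h \<in> L2 N"
  shows "l2_inner N (\<lambda>x. f x - g x) h = l2_inner N f h - l2_inner N g h"
  using assms by (simp add: l2_inner_def left_diff_distrib integrable_mult_L2)

lemma l2_inner_sum_left:
  fixes m :: nat
  assumes "\<And>i. w i \<in> L2 N" "h \<in> L2 N"
  shows "l2_inner N (\<lambda>x. \<Sum>i<m. w i x) h = (\<Sum>i<m. l2_inner N (w i) h)"
  unfolding l2_inner_def sum_distrib_right
  by (rule Bochner_Integration.integral_sum) (use assms in \<open>auto intro: integrable_mult_L2\<close>)

lemma l2_inner_cong_AE:
  assumes "f \<in> L2 N" "g \<in> L2 N" "h \<in> L2 N" "AE x in N. f x = c * g x"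
  shows "l2_inner N f h = c * l2_inner N g h"
proof -
  have "l2_inner N f h = (\<integral>x. c * (g x * h x) \<partial>N)"
    unfolding l2_inner_def
  proof (rule integral_cong_AE)
    show "AE x in N. f x * h x = c * (g x * h x)" using assms(4) by eventually_elim simp
  qed (use assms(1-3)[THEN L2_D(1)] in measurable)
  then show ?thesis by (simp add: l2_inner_def)
qed

lemma l2_inner_self_nonneg: "0 \<le> l2_inner N f f"
  by (simp add: l2_inner_def)

lemma l2_norm_nonneg: "0 \<le> l2_norm N f"
  by (simp add: l2_norm_def l2_inner_self_nonneg)

lemma l2_norm_square: "(l2_norm N f)\<^sup>2 = l2_inner N f f"
  by (simp add: l2_norm_def l2_inner_self_nonneg)

lemma abs_l2_inner_le:
  assumes "f \<in> L2 N" "g \<in> L2 N"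
  shows "\<bar>l2_inner N f g\<bar> \<le> l2_norm N f * l2_norm N g"
proof -
  define A B H where "A = l2_inner N f f" and "B = l2_inner N g g" and "H = l2_inner N f g"
  have quad: "0 \<le> A - 2 * t * H + t\<^sup>2 * B" for t
  proof -
    have "0 \<le> (\<integral>x. (f x - t * g x)\<^sup>2 \<partial>N)" by simp
    also have "(\<lambda>x. (f x - t * g x)\<^sup>2)
        = (\<lambda>x. f x * f x - 2 * t * (f x * g x) + t\<^sup>2 * (g x * g x))"
      by (simp add: power2_eq_square algebra_simps)
    also have "(\<integral>x. f x * f x - 2 * t * (f x * g x) + t\<^sup>2 * (g x * g x) \<partial>N) = A - 2 * t * H + t\<^sup>2 * B"
      unfolding A_def B_def H_def l2_inner_def using assms by (simp add: integrable_mult_L2)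
    finally show ?thesis .
  qed
  have "B \<ge> 0" by (simp add: B_def l2_inner_self_nonneg)
  have "H\<^sup>2 \<le> A * B"
  proof (cases "B = 0")
    case True
    have "H = 0"
    proof (rule ccontr)
      assume "H \<noteq> 0"
      \<comment> \<open>For \<open>B = 0\<close> the quadratic is affine in \<open>t\<close>, and
        this \<open>t\<close> gives it the value -1. For \<open>B > 0\<close> the choice
        \<open>H / B\<close> below is its minimiser.\<close>
      then show False using quad[of "(A + 1) / (2 * H)"] True by simp
    qed
    then show ?thesis using True by simp
  next
    case False
    then show ?thesis using quad[of "H / B"] \<open>B \<ge> 0\<close> by (simp add: power2_eq_square field_simps)
  qed
  then have "\<bar>H\<bar> \<le> sqrt (A * B)" by (simp add: real_le_rsqrt)
  then show ?thesis by (simp add: A_def B_def H_def l2_norm_def real_sqrt_mult)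
qed

section \<open>Projections in an orthogonal decomposition\<close>

context
  fixes N :: "'b measure" and W :: "nat \<Rightarrow> ('b \<Rightarrow> real) set"
  assumes W: "orthogonal_decomposition N W"
begin

lemma W_subset_L2: "u \<in> W i \<Longrightarrow> u \<in> L2 N"
  using W by (auto simp: orthogonal_decomposition_def l2_subspace_def)

lemma W_diff: "u \<in> W i \<Longrightarrow> v \<in> W i \<Longrightarrow> (\<lambda>x. u x - v x) \<in> W i"
proof -
  assume u: "u \<in> W i" and v: "v \<in> W i"
  have "l2_subspace N (W i)" using W by (simp add: orthogonal_decomposition_def)
  then have "\<forall>f\<in>W i. \<forall>g\<in>W i. \<forall>a b. (\<lambda>x. a * f x + b * g x) \<in> W i"
    by (simp add: l2_subspace_def)
  from this[rule_format, OF u v, of 1 "-1"] show ?thesis by simp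
qed

text \<open>The components \<open>w i\<close> of a norm-convergent expansion of \<open>f\<close>
  witness the choice in \<open>l2_proj\<close>. The chosen representative may differ from
  \<open>w i\<close> on a null set, so the two are compared through inner products only.\<close>

lemma
  assumes f: "f \<in> L2 N"
  shows l2_proj_in: "l2_proj N (W i) f \<in> W i"
    and l2_inner_l2_proj: "h \<in> W i \<Longrightarrow> l2_inner N (l2_proj N (W i) f) h = l2_inner N f h"
    and l2_proj_sums: "g \<in> L2 N \<Longrightarrow> (\<lambda>i. l2_inner N (l2_proj N (W i) f) g) sums l2_inner N f g"
proof -
  obtain w where w: "\<And>i. w i \<in> W i"
    and lim: "(\<lambda>m. l2_norm N (\<lambda>x. f x - (\<Sum>i<m. w i x))) \<longlonglongrightarrow> 0"
    using W f unfolding orthogonal_decomposition_def by blast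
  note wL2 = W_subset_L2[OF w]
  \<comment> \<open>Norm convergence becomes convergence of inner products by
    Cauchy-Schwarz.\<close>
  have sums: "(\<lambda>i. l2_inner N (w i) g) sums l2_inner N f g" if g: "g \<in> L2 N" for g
  proof -
    have "(\<lambda>m. l2_inner N f g - (\<Sum>i<m. l2_inner N (w i) g)) \<longlonglongrightarrow> 0"
    proof (rule Lim_null_comparison)
      show "(\<lambda>m. l2_norm N (\<lambda>x. f x - (\<Sum>i<m. w i x)) * l2_norm N g) \<longlonglongrightarrow> 0"
        using tendsto_mult_left_zero[OF lim] .
      have "norm (l2_inner N f g - (\<Sum>i<m. l2_inner N (w i) g))
          \<le> l2_norm N (\<lambda>x. f x - (\<Sum>i<m. w i x)) * l2_norm N g" for m
        using abs_l2_inner_le[OF L2_diff[OF f L2_sum[of w N m]] g]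
        by (simp add: l2_inner_diff_left l2_inner_sum_left L2_sum f g wL2)
      then show "\<forall>\<^sub>F m in sequentially. norm (l2_inner N f g - (\<Sum>i<m. l2_inner N (w i) g))
          \<le> l2_norm N (\<lambda>x. f x - (\<Sum>i<m. w i x)) * l2_norm N g" by simp
    qed
    then have "(\<lambda>m. l2_inner N f g - (l2_inner N f g - (\<Sum>i<m. l2_inner N (w i) g)))
        \<longlonglongrightarrow> l2_inner N f g - 0"
      by (intro tendsto_diff tendsto_const)
    then show ?thesis by (simp add: sums_def)
  qed
  \<comment> \<open>Orthogonality leaves only the \<open>i\<close>-th term of the expansion paired
    with \<open>h\<close>.\<close>
  have w_inner: "l2_inner N (w i) h = l2_inner N f h" if "h \<in> W i" for i h
  proof -
    have "(\<lambda>k. l2_inner N (w k) h) = (\<lambda>k. if k = i then l2_inner N (w i) h else 0)"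
      using W w that unfolding orthogonal_decomposition_def by (intro ext) auto
    then have "(\<lambda>k. l2_inner N (w k) h) sums l2_inner N (w i) h"
      using sums_single[of i "\<lambda>k. l2_inner N (w k) h"] by (simp add: if_distrib cong: if_cong)
    then show ?thesis using sums_unique2[OF _ sums[OF W_subset_L2[OF that]]] by simp
  qed
  have proj: "l2_proj N (W i) f \<in> W i \<and> (\<forall>h\<in>W i. l2_inner N (\<lambda>x. f x - l2_proj N (W i) f x) h = 0)" for i
    unfolding l2_proj_def
  proof (rule someI[of _ "w i"], intro conjI ballI w)
    fix h assume "h \<in> W i"
    then show "l2_inner N (\<lambda>x. f x - w i x) h = 0"
      using w_inner W_subset_L2[of h i] f wL2 by (simp add: l2_inner_diff_left)
  qed
  then show in_W: "l2_proj N (W i) f \<in> W i" for i by blast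
  then show inner: "l2_inner N (l2_proj N (W i) f) h = l2_inner N f h" if "h \<in> W i" for i h
  proof -
    have "l2_inner N (\<lambda>x. f x - l2_proj N (W i) f x) h = 0"
      using proj[of i] that by blast
    then show ?thesis
      using l2_inner_diff_left[OF f W_subset_L2[OF in_W] W_subset_L2[OF that]] by simp
  qed
  assume g: "g \<in> L2 N"
  \<comment> \<open>The difference of the two candidates lies in \<open>W i\<close> and is
    orthogonal to \<open>W i\<close>, hence has norm 0.\<close>
  have "l2_inner N (l2_proj N (W i) f) g = l2_inner N (w i) g" for i
  proof -
    let ?d = "\<lambda>x. l2_proj N (W i) f x - w i x"
    have d: "?d \<in> W i" by (rule W_diff[OF in_W w])
    have "l2_inner N ?d ?d = 0"
      using inner[OF d] w_inner[OF d] W_subset_L2[OF d] W_subset_L2[OF in_W] wL2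
      by (simp add: l2_inner_diff_left)
    then have "\<bar>l2_inner N ?d g\<bar> \<le> 0"
      using abs_l2_inner_le[OF W_subset_L2[OF d] g] by (simp add: l2_norm_def)
    then show ?thesis using W_subset_L2[OF in_W] wL2 g by (simp add: l2_inner_diff_left)
  qed
  then show "(\<lambda>i. l2_inner N (l2_proj N (W i) f) g) sums l2_inner N f g"
    using sums[OF g] by simp
qed

lemma l2_norm_l2_proj_le:
  assumes "f \<in> L2 N"
  shows "l2_norm N (l2_proj N (W i) f) \<le> l2_norm N f"
proof -
  let ?p = "l2_proj N (W i) f"
  have p: "?p \<in> W i" by (rule l2_proj_in[OF assms])
  have "l2_norm N ?p * l2_norm N ?p = l2_inner N f ?p"
    using l2_inner_l2_proj[OF assms p] by (simp add: l2_norm_square flip: power2_eq_square)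
  also have "\<dots> \<le> l2_norm N f * l2_norm N ?p"
    using abs_l2_inner_le[OF assms W_subset_L2[OF p]] by simp
  finally show ?thesis
    using l2_norm_nonneg[of N f] l2_norm_nonneg[of N ?p] by (auto simp: mult_le_cancel_right)
qed

text \<open>Supplies the uniform coefficient bound that the power series estimates require.\<close>

lemma abs_l2_inner_l2_proj_le_1:
  assumes "f \<in> L2 N" "g \<in> L2 N" "l2_norm N f \<le> 1" "l2_norm N g \<le> 1"
  shows "\<bar>l2_inner N (l2_proj N (W i) f) (l2_proj N (W i) g)\<bar> \<le> 1"
proof -
  have "\<bar>l2_inner N (l2_proj N (W i) f) (l2_proj N (W i) g)\<bar>
      \<le> l2_norm N (l2_proj N (W i) f) * l2_norm N (l2_proj N (W i) g)"
    by (intro abs_l2_inner_le W_subset_L2[OF l2_proj_in] assms)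
  also have "\<dots> \<le> 1 * 1"
    using assms l2_norm_l2_proj_le by (intro mult_mono) (auto intro: order_trans l2_norm_nonneg)
  finally show ?thesis by simp
qed

lemma l2_inner_l2_proj_sums:
  assumes f: "f \<in> L2 N" and g: "g \<in> L2 N"
  shows "(\<lambda>i. l2_inner N (l2_proj N (W i) f) (l2_proj N (W i) g)) sums l2_inner N f g"
  using l2_proj_sums[OF f g] l2_inner_l2_proj[OF g l2_proj_in[OF f]]
  by (simp add: l2_inner_commute)

text \<open>Symmetry moves \<open>T\<close> onto \<open>g\<close>, so that no continuity of \<open>T\<close> is needed.\<close>

lemma symmetric_eigen_sums:
  assumes f: "f \<in> L2 N" and g: "g \<in> L2 N"
    and T: "\<And>h. h \<in> L2 N \<Longrightarrow> T h \<in> L2 N"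
    and sym: "\<And>u v. u \<in> L2 N \<Longrightarrow> v \<in> L2 N \<Longrightarrow> l2_inner N u (T v) = l2_inner N (T u) v"
    and eig: "\<And>i u. u \<in> W i \<Longrightarrow> AE x in N. T u x = \<mu> ^ i * u x"
  shows "(\<lambda>i. l2_inner N (l2_proj N (W i) f) (l2_proj N (W i) g) * \<mu> ^ i) sums l2_inner N (T f) g"
proof -
  have "(\<lambda>i. l2_inner N (l2_proj N (W i) f) (T g)) sums l2_inner N f (T g)"
    using f T[OF g] by (rule l2_proj_sums)
  moreover have "l2_inner N (l2_proj N (W i) f) (T g)
      = l2_inner N (l2_proj N (W i) f) (l2_proj N (W i) g) * \<mu> ^ i" for i
  proof -
    let ?p = "l2_proj N (W i) f"
    have p: "?p \<in> W i" "?p \<in> L2 N" using l2_proj_in[OF f] W_subset_L2 by auto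
    have "l2_inner N ?p (T g) = l2_inner N (T ?p) g" by (rule sym[OF p(2) g])
    also have "\<dots> = \<mu> ^ i * l2_inner N ?p g"
      using T p g eig[OF p(1)] by (intro l2_inner_cong_AE) auto
    also have "l2_inner N ?p g = l2_inner N ?p (l2_proj N (W i) g)"
      using l2_inner_l2_proj[OF g p(1)] by (simp add: l2_inner_commute)
    finally show ?thesis by simp
  qed
  ultimately show ?thesis using sym[OF f g] by simp
qed

end

section \<open>Exponential form of the eigenvalues\<close>

text \<open>The function \<open>- ln (\<mu> t)\<close> solves Cauchy's additive equation on the
  half-line, and monotonicity replaces continuity in forcing it to be linear. Positivity comes from
  strict decrease: \<open>\<mu> t\<close> exceeds the nonnegative
  \<open>\<mu> (t + 1)\<close>.\<close>

lemma strict_antimono_multiplicative_exp: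
  fixes \<mu> :: "real \<Rightarrow> real"
  assumes nonneg: "\<And>t. 0 \<le> t \<Longrightarrow> 0 \<le> \<mu> t"
    and mult: "\<And>s t. 0 \<le> s \<Longrightarrow> 0 \<le> t \<Longrightarrow> \<mu> (s + t) = \<mu> s * \<mu> t"
    and anti: "\<And>s t. 0 \<le> s \<Longrightarrow> s < t \<Longrightarrow> \<mu> t < \<mu> s"
  obtains c where "c > 0" "\<And>t. 0 \<le> t \<Longrightarrow> \<mu> t = exp (- c * t)"
proof -
  have pos: "0 < \<mu> t" if "0 \<le> t" for t
    using nonneg[of "t + 1"] anti[of t "t + 1"] that by simp
  define \<phi> where "\<phi> t = - ln (\<mu> t)" for t
  have add: "\<phi> (s + t) = \<phi> s + \<phi> t" if "0 \<le> s" "0 \<le> t" for s t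
    using that pos[of s] pos[of t] by (simp add: \<phi>_def mult ln_mult)
  have less: "\<phi> s < \<phi> t" if "0 \<le> s" "s < t" for s t
    using anti[OF that] pos[of s] pos[of t] that by (simp add: \<phi>_def)
  have zero: "\<phi> 0 = 0" using add[of 0 0] by simp
  have scale: "\<phi> (real n * t) = real n * \<phi> t" if "0 \<le> t" for n t
  proof (induction n)
    case (Suc n)
    then show ?case using add[of t "real n * t"] that by (simp add: algebra_simps)
  qed (simp add: zero)
  define c where "c = \<phi> 1"
  have "c > 0" using less[of 0 1] by (simp add: c_def zero)
  have mono: "\<phi> s \<le> \<phi> t" if "0 \<le> s" "s \<le> t" for s t
    using less[of s t] that by (cases "s = t") auto
  have lin: "\<phi> t = c * t" if t: "0 \<le> t" for t
  proof -
    \<comment> \<open>Both \<open>\<phi> (n * t)\<close> and \<open>c * n * t\<close> lie between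
      \<open>c * m\<close> and \<open>c * (m + 1)\<close>; since \<open>n\<close> is arbitrary, the
      Archimedean property gives equality.\<close>
    have "real n * \<bar>\<phi> t - c * t\<bar> \<le> c" for n
    proof -
      define m where "m = nat \<lfloor>real n * t\<rfloor>"
      have m: "real m \<le> real n * t" "real n * t \<le> real m + 1"
        using t by (simp_all add: m_def)
      have "\<phi> (real m * 1) \<le> \<phi> (real n * t)" using m by (intro mono) auto
      moreover have "\<phi> (real n * t) \<le> \<phi> (real (Suc m) * 1)" using m t by (intro mono) auto
      ultimately have "real m * c \<le> real n * \<phi> t" "real n * \<phi> t \<le> (real m + 1) * c"
        using scale[of 1 m] scale[of 1 "Suc m"] scale[OF t, of n] by (simp_all add: c_def algebra_simps)
      moreover have "real m * c \<le> real n * t * c" "real n * t * c \<le> (real m + 1) * c"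
        using m \<open>c > 0\<close> by (auto intro: mult_right_mono)
      ultimately have "\<bar>real n * \<phi> t - real n * t * c\<bar> \<le> c"
        by (simp add: algebra_simps abs_le_iff)
      moreover have "real n * \<phi> t - real n * t * c = real n * (\<phi> t - c * t)"
        by (simp add: algebra_simps)
      ultimately show ?thesis by (simp add: abs_mult)
    qed
    then have "\<not> 0 < \<bar>\<phi> t - c * t\<bar>"
      using reals_Archimedean3[of "\<bar>\<phi> t - c * t\<bar>"] not_less by blast
    then show ?thesis by simp
  qed
  have "\<mu> t = exp (- c * t)" if "0 \<le> t" for t
  proof -
    have "ln (\<mu> t) = - c * t" using lin[OF that] by (simp add: \<phi>_def)
    then show ?thesis using pos[OF that] exp_ln[of "\<mu> t"] by simp
  qed
  then show thesis using that \<open>c > 0\<close> by blast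
qed

lemma semigroup_eigenvalue_mult:
  assumes P: "markov_semigroup N P" and u: "u \<in> L2 N" and nz: "\<not> (AE x in N. u x = 0)"
    and eig: "\<And>t. 0 \<le> t \<Longrightarrow> AE x in N. P t u x = \<mu> t * u x"
    and s: "0 \<le> s" and t: "0 \<le> t"
  shows "\<mu> (s + t) = \<mu> s * \<mu> t"
proof (rule ccontr)
  assume ne: "\<mu> (s + t) \<noteq> \<mu> s * \<mu> t"
  have op: "l2_operator N (P s)" "l2_operator N (P t)" and
    comp: "AE x in N. P s (P t u) x = P (s + t) u x"
    using P s t u by (auto simp: markov_semigroup_def)
  \<comment> \<open>The summand \<open>0 * u x\<close> puts the multiple of \<open>u\<close> into
    the two-term shape of the linearity clause of \<open>l2_operator\<close>.\<close>
  have scaled: "(\<lambda>x. \<mu> t * u x + 0 * u x) \<in> L2 N" by (rule L2_lincomb[OF u u])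
  have "P t u \<in> L2 N" using op u by (auto simp: l2_operator_def)
  moreover have "AE x in N. P t u x = \<mu> t * u x + 0 * u x" using eig[OF t] by simp
  ultimately have "AE x in N. P s (P t u) x = P s (\<lambda>x. \<mu> t * u x + 0 * u x) x"
    using op(1) scaled by (simp only: l2_operator_def)
  moreover have "AE x in N. P s (\<lambda>x. \<mu> t * u x + 0 * u x) x = \<mu> t * P s u x + 0 * P s u x"
    using op(1) u by (simp only: l2_operator_def)
  moreover have "AE x in N. P (s + t) u x = \<mu> (s + t) * u x" using s t by (intro eig) simp
  ultimately have "AE x in N. u x = 0"
    using comp eig[OF s] by eventually_elim (use ne in \<open>auto simp: mult_ac\<close>)
  with nz show False by blast
qed

section \<open>From the semigroup to a monotone power series\<close>

lemma chaos_correlation_ge_Phi: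
  assumes N: "prob_space N" and P: "markov_semigroup N P" and sym: "symmetric_semigroup N P"
    and chaos: "chaos_decomposition N P W"
    and f: "f \<in> L2 N" and g: "g \<in> L2 N" and norm: "l2_norm N f \<le> 1" "l2_norm N g \<le> 1"
    and decr: "\<And>t. 0 < t \<Longrightarrow> \<exists>D\<le>0. ((\<lambda>s. l2_inner N (P s f) g) has_real_derivative D) (at t)"
    and j: "0 < j"
    and supp: "\<And>l. \<not> j dvd l \<Longrightarrow> AE x in N. l2_proj N (W l) f x = 0"
  shows "l2_inner N (l2_proj N (W j) f) (l2_proj N (W j) g) \<in> {0..1}"
    and "l2_inner N f g - l2_inner N f (\<lambda>_. 1) * l2_inner N g (\<lambda>_. 1)
      \<ge> 1 / 10 ^ 6 * Phi (l2_inner N (l2_proj N (W j) f) (l2_proj N (W j) g))"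
proof -
  interpret prob_space N by (rule N)
  have W: "orthogonal_decomposition N W"
    and W0: "W 0 = {f \<in> L2 N. \<exists>c. AE x in N. f x = c}"
    using chaos by (auto simp: chaos_decomposition_def)
  obtain \<mu> :: "real \<Rightarrow> real"
    where range_eig: "\<forall>t\<ge>0. \<mu> t \<in> {0..1} \<and> (\<forall>i. \<forall>f\<in>W i. AE x in N. P t f x = \<mu> t ^ i * f x)"
      and decr_eig: "\<forall>t1 t2. 0 \<le> t2 \<and> t2 < t1 \<longrightarrow> \<mu> t1 < \<mu> t2"
    using chaos unfolding chaos_decomposition_def by (elim conjE exE)
  have \<mu>: "0 \<le> \<mu> t" if "0 \<le> t" for t
    using range_eig[rule_format, OF that] by simp
  have eig: "AE x in N. P t u x = \<mu> t ^ i * u x" if "0 \<le> t" "u \<in> W i" for t i u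
    using conjunct2[OF range_eig[rule_format, OF that(1)]] that(2) by simp
  have anti: "\<mu> t < \<mu> s" if "0 \<le> s" "s < t" for s t
    using decr_eig that by simp
  define A where "A i = l2_inner N (l2_proj N (W i) f) (l2_proj N (W i) g)" for i
  define a where "a l = A (l * j)" for l
  note proj_L2 = W_subset_L2[OF W l2_proj_in[OF W]]
  have A_le: "\<bar>A i\<bar> \<le> 1" for i
    unfolding A_def by (rule abs_l2_inner_l2_proj_le_1[OF W f g norm])
  have A_zero: "A i = 0" if "AE x in N. l2_proj N (W i) f x = 0" for i
    unfolding A_def l2_inner_def
    by (rule integral_eq_zero_AE) (use that in eventually_elim, simp)
  \<comment> \<open>Only multiples of \<open>j\<close> contribute, so the series in \<open>y\<close>
    is a series in \<open>y ^ j\<close>; in it, level \<open>j\<close> becomes the linear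
    coefficient.\<close>
  have reindex: "(\<lambda>l. a l * x ^ l) sums s \<longleftrightarrow> (\<lambda>i. A i * y ^ i) sums s" if "y ^ j = x" for x y s
  proof -
    have "strict_mono (\<lambda>l. l * j)" using j by (simp add: strict_mono_def)
    moreover have "A i * y ^ i = 0" if "i \<notin> range (\<lambda>l. l * j)" for i
    proof -
      have "\<not> j dvd i" using that by (auto elim!: dvdE simp: mult.commute)
      then show ?thesis using A_zero supp by simp
    qed
    ultimately have "(\<lambda>l. A (l * j) * y ^ (l * j)) sums s \<longleftrightarrow> (\<lambda>i. A i * y ^ i) sums s"
      by (rule sums_mono_reindex)
    moreover have "y ^ (l * j) = x ^ l" for l
      using that by (metis mult.commute power_mult)
    ultimately show ?thesis by (simp add: a_def)
  qed
  have sums1: "a sums l2_inner N f g"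
    using reindex[of 1 1] l2_inner_l2_proj_sums[OF W f g] by (simp add: A_def)
  have one: "(\<lambda>_. 1) \<in> W 0" unfolding W0 by (auto simp: L2_def)
  \<comment> \<open>Elements of \<open>W 0\<close> are almost everywhere constant, so the projection
    onto it is the mean.\<close>
  have a0: "a 0 = l2_inner N f (\<lambda>_. 1) * l2_inner N g (\<lambda>_. 1)"
  proof -
    have const: "AE x in N. l2_proj N (W 0) h x = l2_inner N h (\<lambda>_. 1) * 1" if h: "h \<in> L2 N" for h
    proof -
      obtain c where c: "AE x in N. l2_proj N (W 0) h x = c"
        using l2_proj_in[OF W h, of 0] unfolding W0 by blast
      have "l2_inner N h (\<lambda>_. 1) = l2_inner N (l2_proj N (W 0) h) (\<lambda>_. 1)"
        using l2_inner_l2_proj[OF W h one] by simp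
      also have "\<dots> = c * l2_inner N (\<lambda>_. 1) (\<lambda>_. 1)"
        using c by (intro l2_inner_cong_AE proj_L2[OF h] W_subset_L2[OF W one]) simp
      also have "\<dots> = c" by (simp add: l2_inner_def prob_space)
      finally show ?thesis using c by simp
    qed
    have "A 0 = l2_inner N f (\<lambda>_. 1) * l2_inner N (\<lambda>_. 1) (l2_proj N (W 0) g)"
      unfolding A_def
      by (intro l2_inner_cong_AE proj_L2 f g W_subset_L2[OF W one] const)
    also have "l2_inner N (\<lambda>_. 1) (l2_proj N (W 0) g) = l2_inner N g (\<lambda>_. 1)"
      using l2_inner_l2_proj[OF W g one] by (simp add: l2_inner_commute)
    finally show ?thesis by (simp add: a_def)
  qed
  have "0 \<le> a 1 \<and> l2_inner N f g - a 0 \<ge> 1 / 10 ^ 6 * Phi (a 1)"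
  \<comment> \<open>If all higher coefficients vanish, both sides are 0. Otherwise some
    \<open>W i\<close> with \<open>i \<ge> 1\<close> contains a nonzero vector, which is what
    transfers the semigroup law to the eigenvalues.\<close>
  proof (cases "\<exists>i\<ge>1. A i \<noteq> 0")
    case False
    then have "a l = 0" if "l \<notin> {0}" for l using j that by (auto simp: a_def)
    then have "a sums a 0" using sums_finite[of "{0}" a] by simp
    then have "l2_inner N f g = a 0" using sums1 sums_unique2 by blast
    moreover have "a 1 = 0" using False j by (auto simp: a_def)
    ultimately show ?thesis by (simp add: Phi_def)
  next
    case True
    then obtain i where i: "i \<ge> 1" "A i \<noteq> 0" by blast
    define u where "u = l2_proj N (W i) f"
    have u: "u \<in> W i" "u \<in> L2 N" "\<not> (AE x in N. u x = 0)"
      using l2_proj_in[OF W f] proj_L2[OF f] A_zero[of i] i by (auto simp: u_def)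
    \<comment> \<open>The eigenvector gives the law for \<open>i\<close>-th powers; nonnegativity
      and \<open>i \<ge> 1\<close> permit taking roots.\<close>
    have "\<mu> (s + t) = \<mu> s * \<mu> t" if "0 \<le> s" "0 \<le> t" for s t
    proof -
      have "\<mu> (s + t) ^ i = \<mu> s ^ i * \<mu> t ^ i"
        using semigroup_eigenvalue_mult[OF P u(2,3), of "\<lambda>t. \<mu> t ^ i"] eig[OF _ u(1)] that by blast
      then have "\<mu> (s + t) ^ i = (\<mu> s * \<mu> t) ^ i" by (simp add: power_mult_distrib)
      then show ?thesis
        using i that \<mu> by (subst (asm) power_eq_iff_eq_base) auto
    qed
    then obtain c where c: "c > 0" "\<And>t. 0 \<le> t \<Longrightarrow> \<mu> t = exp (- c * t)"
      using strict_antimono_multiplicative_exp[of \<mu>] \<mu> anti by blast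
    \<comment> \<open>The time at which \<open>\<mu> t ^ j\<close> equals \<open>x\<close>. It
      decreases in \<open>x\<close>, so decay in time turns into growth in \<open>x\<close>.\<close>
    define T where "T x = - ln x / (c * real j)" for x
    have T: "0 < T x" "\<mu> (T x) ^ j = x" if "0 < x" "x < 1" for x
    proof -
      show "0 < T x" using that c j by (simp add: T_def divide_neg_pos)
      then have "\<mu> (T x) ^ j = exp (real j * (- c * T x))" using c(2)[of "T x"] by (simp flip: exp_of_nat_mult)
      also have "real j * (- c * T x) = ln x" using c j by (simp add: T_def)
      finally show "\<mu> (T x) ^ j = x" using that by simp
    qed
    have eval: "(\<Sum>l. a l * x ^ l) = l2_inner N (P (T x) f) g" if "0 < x" "x < 1" for x
    proof -
      have t: "0 \<le> T x" using T[OF that] by simp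
      have "(\<lambda>i. A i * \<mu> (T x) ^ i) sums l2_inner N (P (T x) f) g"
        unfolding A_def
      proof (rule symmetric_eigen_sums[OF W f g])
        show "P (T x) h \<in> L2 N" if "h \<in> L2 N" for h
          using P t that by (simp add: markov_semigroup_def l2_operator_def)
        show "l2_inner N u (P (T x) v) = l2_inner N (P (T x) u) v" if "u \<in> L2 N" "v \<in> L2 N" for u v
          using sym t that by (simp add: symmetric_semigroup_def)
      qed (rule eig[OF t])
      then have "(\<lambda>l. a l * x ^ l) sums l2_inner N (P (T x) f) g"
        using reindex[OF T(2)[OF that]] by blast
      then show ?thesis by (simp add: sums_iff)
    qed
    have mono: "(\<Sum>l. a l * x ^ l) \<le> (\<Sum>l. a l * y ^ l)" if "0 < x" "x \<le> y" "y < 1" for x y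
    proof -
      have le: "T y \<le> T x" using that c j by (simp add: T_def divide_right_mono)
      have "0 < T y" using T[of y] that by simp
      have "l2_inner N (P (T x) f) g \<le> l2_inner N (P (T y) f) g"
      proof (rule DERIV_nonpos_imp_nonincreasing[of "T y" "T x" "\<lambda>s. l2_inner N (P s f) g"])
        fix t assume "T y \<le> t"
        then have "0 < t" using \<open>0 < T y\<close> by simp
        from decr[OF this]
        show "\<exists>D. ((\<lambda>s. l2_inner N (P s f) g) has_real_derivative D) (at t) \<and> D \<le> 0" by blast
      qed (rule le)
      then show ?thesis using eval that by simp
    qed
    have "\<bar>a n\<bar> \<le> 1" for n unfolding a_def by (rule A_le)
    from mono_powser_increment_ge_Phi[of a, OF this sums1 mono] show ?thesis by simp
  qed
  then show "l2_inner N (l2_proj N (W j) f) (l2_proj N (W j) g) \<in> {0..1}"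
    and "l2_inner N f g - l2_inner N f (\<lambda>_. 1) * l2_inner N g (\<lambda>_. 1)
      \<ge> 1 / 10 ^ 6 * Phi (l2_inner N (l2_proj N (W j) f) (l2_proj N (W j) g))"
    using A_le[of j] a0 by (auto simp: a_def A_def)
qed

(* The bound C \<le> 10^6 makes the constant universal: a formula cannot quantify over the type
   'a of the underlying set of the probability space, so without an a priori bound C could
   depend on 'a. *)
theorem theorem15:
  shows "\<exists>C::real. 0 < C \<and> C \<le> 10 ^ 6 \<and>
    (\<forall>(M :: 'a measure) (n :: nat) N P W F (j :: nat).
       prob_space M \<longrightarrow> 1 \<le> n \<longrightarrow>
       N = (\<Pi>\<^sub>M i\<in>{..<n}. M) \<longrightarrow>
       markov_semigroup N P \<longrightarrow>
       symmetric_semigroup N P \<longrightarrow>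
       chaos_decomposition N P W \<longrightarrow>
       F \<subseteq> L2 N \<longrightarrow>
       (\<forall>f\<in>F. l2_norm N f \<le> 1) \<longrightarrow>
       monotone_compatible N P F \<longrightarrow>
       0 < j \<longrightarrow>
       (\<forall>f\<in>F. \<forall>l. \<not> j dvd l \<longrightarrow> (AE x in N. l2_proj N (W l) f x = 0)) \<longrightarrow>
       (\<forall>f\<in>F. \<forall>g\<in>F.
          l2_inner N (l2_proj N (W j) f) (l2_proj N (W j) g) \<in> {0..1} \<and>
          l2_inner N f g - l2_inner N f (\<lambda>_. 1) * l2_inner N g (\<lambda>_. 1)
            \<ge> 1 / C * Phi (l2_inner N (l2_proj N (W j) f) (l2_proj N (W j) g))))"
proof (rule exI[of _ "10 ^ 6"], intro conjI allI impI ballI)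
  fix M :: "'a measure" and n :: nat and N P W F and j :: nat and f g
  assume M: "prob_space M" and N: "N = (\<Pi>\<^sub>M i\<in>{..<n}. M)"
    and P: "markov_semigroup N P" "symmetric_semigroup N P" "chaos_decomposition N P W"
    and F: "F \<subseteq> L2 N" "\<forall>f\<in>F. l2_norm N f \<le> 1" "monotone_compatible N P F"
    and j: "0 < j" and supp: "\<forall>f\<in>F. \<forall>l. \<not> j dvd l \<longrightarrow> (AE x in N. l2_proj N (W l) f x = 0)"
    and fg: "f \<in> F" "g \<in> F"
  have "prob_space N" unfolding N by (rule prob_space_PiM[OF M])
  note bound = chaos_correlation_ge_Phi[OF this P, of f g j]
  have decr: "\<exists>D\<le>0. ((\<lambda>s. l2_inner N (P s f) g) has_real_derivative D) (at t)" if "0 < t" for t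
    using F(3) fg that by (simp add: monotone_compatible_def)
  show "l2_inner N (l2_proj N (W j) f) (l2_proj N (W j) g) \<in> {0..1}"
    by (rule bound(1)) (use F fg j supp decr in auto)
  show "l2_inner N f g - l2_inner N f (\<lambda>_. 1) * l2_inner N g (\<lambda>_. 1)
      \<ge> 1 / 10 ^ 6 * Phi (l2_inner N (l2_proj N (W j) f) (l2_proj N (W j) g))"
    by (rule bound(2)) (use F fg j supp decr in auto)
qed simp_all

end
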